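(* Let $O$ be a locally finite totally ordered set. For all $A,B,C\in\mathscr E_O$, \[(A\vee B)<C=(A<C)\vee(B<C),\qquad A<(B\vee C)=(A<B)\vee(A<C).\]
   Context: $\mathscr E_O$ is the set of antichains with respect to inclusion of finite intervals (convex subsets, including $\emptyset$) of the totally ordered set $(O,\sqsubseteq)$, ordered by $A\le B$ iff for every $I\in A$ there is $J\in B$ with $J\subseteq I$; it is a complete lattice with top $1=\{\emptyset\}$. The ordered non-overlapping meet is defined for $A,B\ne1$ by $A<B=\bigvee\{\{[\min I..\max J]\}: I\in A,\ J\in B,\ \max I\sqsubset\min J\}$ (join in $\mathscr E_O$, where $[a..b]=\{x:a\sqsubseteq x\sqsubseteq b\}$), and $1$ is declared an identity: $1<A=A<1=A$. *)

theory Defs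
  imports "HOL-Algebra.Complete_Lattice"
begin

text \<open>
  A totally ordered set is represented by a set \<open>X\<close> of elements of a linearly ordered type, with
  the inherited order. It may be empty, and all intervals are relative to \<open>X\<close>.
\<close>

definition interval_in :: "'a::linorder set \<Rightarrow> 'a \<Rightarrow> 'a \<Rightarrow> 'a set"
  where "interval_in X a b = {x \<in> X. a \<le> x \<and> x \<le> b}"

definition locally_finite_order :: "'a::linorder set \<Rightarrow> bool"
  where "locally_finite_order X \<longleftrightarrow> (\<forall>a\<in>X. \<forall>b\<in>X. finite (interval_in X a b))"

definition convex_subset :: "'a::linorder set \<Rightarrow> 'a set \<Rightarrow> bool"
  where "convex_subset X I \<longleftrightarrow> I \<subseteq> X \<and> (\<forall>a\<in>I. \<forall>b\<in>I. interval_in X a b \<subseteq> I)"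

definition finite_intervals :: "'a::linorder set \<Rightarrow> 'a set set"
  where "finite_intervals X = {I. finite I \<and> convex_subset X I}"

definition incl_antichain :: "'a set set \<Rightarrow> bool"
  where "incl_antichain A \<longleftrightarrow> (\<forall>I\<in>A. \<forall>J\<in>A. I \<subseteq> J \<longrightarrow> I = J)"

definition \<E> :: "'a::linorder set \<Rightarrow> 'a set set gorder"
  where "\<E> X =
    \<lparr> carrier = {A. A \<subseteq> finite_intervals X \<and> incl_antichain A},
      eq = (=),
      le = (\<lambda>A B. \<forall>I\<in>A. \<exists>J\<in>B. J \<subseteq> I) \<rparr>"

text \<open>
  \<open>Min\<close> and \<open>Max\<close> are only applied to nonempty sets: an antichain containing \<open>{}\<close> is \<open>{{}}\<close>,
  the top element.
\<close>

definition ordered_meet :: "'a::linorder set \<Rightarrow> 'a set set \<Rightarrow> 'a set set \<Rightarrow> 'a set set"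
  where "ordered_meet X A B =
    (if A = {{}} then B
     else if B = {{}} then A
     else \<Squnion>\<^bsub>\<E> X\<^esub> {{interval_in X (Min I) (Max J)} | I J. I \<in> A \<and> J \<in> B \<and> Max I < Min J})"

text \<open>
  The joins used here are least upper bounds in \<open>\<E> X\<close>. They exist because \<open>\<E> X\<close> is a complete
  lattice, and if \<open>X\<close> is locally finite, the singletons joined in \<open>ordered_meet\<close> belong to it.
\<close>

lemma minimal_member_exists:
  assumes "U \<subseteq> finite_intervals X" and "I \<in> U"
  shows "\<exists>J\<in>U. J \<subseteq> I \<and> (\<forall>K\<in>U. K \<subseteq> J \<longrightarrow> K = J)"
proof -
  let ?W = "{J \<in> U. J \<subseteq> I}"
  have "finite I" using assms by (auto simp: finite_intervals_def)
  then have "finite ?W" by (intro finite_subset[of ?W "Pow I"]) auto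
  moreover have "?W \<noteq> {}" using assms by auto
  ultimately obtain J where "J \<in> ?W" and "\<forall>K\<in>?W. K \<subseteq> J \<longrightarrow> J = K"
    using finite_has_minimal[of ?W] by blast
  then show ?thesis by (intro bexI[of _ J]) auto
qed

lemma minimal_members:
  assumes "U \<subseteq> finite_intervals X"
  shows "\<exists>M\<in>carrier (\<E> X). M \<subseteq> U \<and> (\<forall>I\<in>U. \<exists>J\<in>M. J \<subseteq> I)"
proof -
  let ?M = "{J \<in> U. \<forall>K\<in>U. K \<subseteq> J \<longrightarrow> K = J}"
  have "?M \<in> carrier (\<E> X)" using assms by (auto simp: \<E>_def incl_antichain_def)
  moreover have "?M \<subseteq> U" by auto
  moreover have "\<forall>I\<in>U. \<exists>J\<in>?M. J \<subseteq> I"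
    using minimal_member_exists[OF assms] by blast
  ultimately show ?thesis by blast
qed

lemma le_\<E>: "A \<sqsubseteq>\<^bsub>\<E> X\<^esub> B \<longleftrightarrow> (\<forall>I\<in>A. \<exists>J\<in>B. J \<subseteq> I)"
  by (simp add: \<E>_def)

lemma partial_order_\<E>: "partial_order (\<E> X)"
proof
  fix A B
  assume A: "A \<in> carrier (\<E> X)" and B: "B \<in> carrier (\<E> X)"
    and AB: "A \<sqsubseteq>\<^bsub>\<E> X\<^esub> B" and BA: "B \<sqsubseteq>\<^bsub>\<E> X\<^esub> A"
  have *: "C \<subseteq> D" if "incl_antichain C" "\<forall>I\<in>C. \<exists>J\<in>D. J \<subseteq> I" "\<forall>I\<in>D. \<exists>J\<in>C. J \<subseteq> I"
    for C D :: "'a set set"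
  proof
    fix I assume "I \<in> C"
    with that(2) obtain J where J: "J \<in> D" "J \<subseteq> I" by blast
    with that(3) obtain K where K: "K \<in> C" "K \<subseteq> J" by blast
    with that(1) \<open>I \<in> C\<close> J have "K = I" unfolding incl_antichain_def by blast
    with J K have "I = J" by simp
    with J show "I \<in> D" by simp
  qed
  from A B AB BA have "A = B"
    by (intro equalityI *) (auto simp: \<E>_def)
  then show "A .=\<^bsub>\<E> X\<^esub> B" by (simp add: \<E>_def)
next
  fix A B C
  assume "A \<sqsubseteq>\<^bsub>\<E> X\<^esub> B" "B \<sqsubseteq>\<^bsub>\<E> X\<^esub> C"
  then show "A \<sqsubseteq>\<^bsub>\<E> X\<^esub> C" unfolding le_\<E> by (meson subset_trans)
qed (auto simp: \<E>_def)

lemma complete_lattice_\<E>: "complete_lattice (\<E> X)"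
proof (rule partial_order.complete_latticeI[OF partial_order_\<E>])
  fix F assume F: "F \<subseteq> carrier (\<E> X)"
  then have "\<Union>F \<subseteq> finite_intervals X" by (auto simp: \<E>_def)
  then obtain M where M: "M \<in> carrier (\<E> X)" "M \<subseteq> \<Union>F" "\<forall>I\<in>\<Union>F. \<exists>J\<in>M. J \<subseteq> I"
    using minimal_members[of "\<Union>F" X] by blast
  have "M \<in> Upper (\<E> X) F"
    using M(1,3) unfolding Upper_def le_\<E> by blast
  moreover have "M \<sqsubseteq>\<^bsub>\<E> X\<^esub> B" if "B \<in> Upper (\<E> X) F" for B
  proof -
    have "A \<sqsubseteq>\<^bsub>\<E> X\<^esub> B" if "A \<in> F" for A
      using that \<open>B \<in> Upper (\<E> X) F\<close> F by (auto simp: Upper_def)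
    then show ?thesis using M(2) unfolding le_\<E> by blast
  qed
  ultimately show "\<exists>s. is_lub (\<E> X) s F"
    unfolding least_def by (auto simp: Upper_def)
next
  fix F assume F: "F \<subseteq> carrier (\<E> X)"
  let ?U = "{I \<in> finite_intervals X. \<forall>A\<in>F. \<exists>J\<in>A. J \<subseteq> I}"
  have "?U \<subseteq> finite_intervals X" by auto
  then obtain M where M: "M \<in> carrier (\<E> X)" "M \<subseteq> ?U" "\<forall>I\<in>?U. \<exists>J\<in>M. J \<subseteq> I"
    using minimal_members[of ?U X] by blast
  have "M \<in> Lower (\<E> X) F"
    using M(1,2) unfolding Lower_def le_\<E> by blast
  moreover have "B \<sqsubseteq>\<^bsub>\<E> X\<^esub> M" if "B \<in> Lower (\<E> X) F" for B
  proof -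
    have "B \<sqsubseteq>\<^bsub>\<E> X\<^esub> A" if "A \<in> F" for A
      using that \<open>B \<in> Lower (\<E> X) F\<close> F by (auto simp: Lower_def)
    moreover have "B \<subseteq> finite_intervals X"
      using that by (simp add: Lower_def \<E>_def)
    ultimately have "B \<subseteq> ?U" unfolding le_\<E> by blast
    with M(3) show ?thesis unfolding le_\<E> by blast
  qed
  ultimately show "\<exists>i. is_glb (\<E> X) i F"
    unfolding greatest_def by (auto simp: Lower_def)
qed

lemma top_\<E>: "\<top>\<^bsub>\<E> X\<^esub> = {{}}"
proof -
  interpret complete_lattice "\<E> X" by (rule complete_lattice_\<E>)
  have one: "{{}} \<in> carrier (\<E> X)"
    by (auto simp: \<E>_def finite_intervals_def convex_subset_def incl_antichain_def)
  have "{{}} \<sqsubseteq>\<^bsub>\<E> X\<^esub> \<top>\<^bsub>\<E> X\<^esub>" using one by (rule top_higher)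
  moreover have "\<top>\<^bsub>\<E> X\<^esub> \<sqsubseteq>\<^bsub>\<E> X\<^esub> {{}}" by (simp add: le_\<E>)
  ultimately show ?thesis
    using one by (intro partial_order.le_antisym[OF partial_order_\<E>]) simp_all
qed

lemma interval_in_\<E>:
  assumes "locally_finite_order X" "a \<in> X" "b \<in> X"
  shows "{interval_in X a b} \<in> carrier (\<E> X)"
proof -
  have "finite (interval_in X a b)"
    using assms by (simp add: locally_finite_order_def)
  moreover have "convex_subset X (interval_in X a b)"
    by (auto simp: convex_subset_def interval_in_def)
  ultimately show ?thesis
    by (simp add: \<E>_def finite_intervals_def incl_antichain_def)
qed

end

theory Submission
  imports Defs
begin

text \<open>
  An antichain is determined by the up-set of finite intervals it generates, and joins become
  unions of up-sets. A finite interval \<open>K\<close> lies in the up-set of the ordered meet of \<open>A\<close> and \<open>B\<close>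
  iff it contains some \<open>I \<in> A\<close> and some \<open>J \<in> B\<close> with \<open>I\<close> entirely to the left of \<open>J\<close>. This
  description also covers the identity, since the empty interval is to the left and to the right
  of everything, and it only depends on the up-sets of \<open>A\<close> and \<open>B\<close>, in each of which it
  distributes over unions.
\<close>

definition upset :: "'a::linorder set \<Rightarrow> 'a set set \<Rightarrow> 'a set set"
  where "upset X A = {K \<in> finite_intervals X. \<exists>I\<in>A. I \<subseteq> K}"

text \<open>Stated elementwise because \<open>Max\<close> and \<open>Min\<close> say nothing useful
  about the empty set; on nonempty finite sets it agrees with \<open>Max I < Min J\<close>.\<close>

definition left_of :: "'a::linorder set \<Rightarrow> 'a set \<Rightarrow> bool"
  where "left_of I J \<longleftrightarrow> (\<forall>x\<in>I. \<forall>y\<in>J. x < y)"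

lemma left_of_mono: "left_of I J \<Longrightarrow> I' \<subseteq> I \<Longrightarrow> J' \<subseteq> J \<Longrightarrow> left_of I' J'"
  unfolding left_of_def by blast

lemma left_of_iff_Max_less_Min:
  assumes "finite I" "I \<noteq> {}" "finite J" "J \<noteq> {}"
  shows "left_of I J \<longleftrightarrow> Max I < Min J"
  using assms by (simp add: left_of_def) blast

lemma carrier_\<E>_subset: "A \<in> carrier (\<E> X) \<Longrightarrow> A \<subseteq> finite_intervals X"
  by (simp add: \<E>_def)

text \<open>The exceptional cases of \<open>ordered_meet\<close> are thus exactly those in which an
  empty interval occurs; outside them \<open>Min\<close> and \<open>Max\<close> are only applied to
  nonempty sets.\<close>

lemma empty_in_\<E>:
  assumes "A \<in> carrier (\<E> X)"
  shows "{} \<in> A \<longleftrightarrow> A = {{}}"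
  using assms by (auto simp: \<E>_def incl_antichain_def)

lemma subset_upset: "A \<in> carrier (\<E> X) \<Longrightarrow> A \<subseteq> upset X A"
  by (auto simp: upset_def dest: carrier_\<E>_subset)

text \<open>One direction is transitivity of inclusion. For the other, each member of
  \<open>A\<close> is a finite interval, hence itself a member of \<open>upset X A\<close>.\<close>

lemma le_\<E>_iff_upset:
  assumes "A \<in> carrier (\<E> X)"
  shows "A \<sqsubseteq>\<^bsub>\<E> X\<^esub> B \<longleftrightarrow> upset X A \<subseteq> upset X B"
proof
  assume le: "A \<sqsubseteq>\<^bsub>\<E> X\<^esub> B"
  show "upset X A \<subseteq> upset X B"
  proof
    fix K assume "K \<in> upset X A"
    then obtain I where "K \<in> finite_intervals X" "I \<in> A" "I \<subseteq> K"
      by (auto simp: upset_def)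
    moreover from le \<open>I \<in> A\<close> obtain J where "J \<in> B" "J \<subseteq> I"
      by (auto simp: le_\<E>)
    ultimately show "K \<in> upset X B" by (auto simp: upset_def)
  qed
next
  assume "upset X A \<subseteq> upset X B"
  then have "A \<subseteq> upset X B" using subset_upset[OF assms] by simp
  then show "A \<sqsubseteq>\<^bsub>\<E> X\<^esub> B" by (auto simp: le_\<E> upset_def)
qed

lemma upset_inject:
  assumes "A \<in> carrier (\<E> X)" "B \<in> carrier (\<E> X)" "upset X A = upset X B"
  shows "A = B"
proof -
  have "A \<sqsubseteq>\<^bsub>\<E> X\<^esub> B" "B \<sqsubseteq>\<^bsub>\<E> X\<^esub> A"
    using assms(3) by (simp_all add: le_\<E>_iff_upset[OF assms(1)] le_\<E>_iff_upset[OF assms(2)])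
  then show ?thesis by (rule partial_order.le_antisym[OF partial_order_\<E> _ _ assms(1,2)])
qed

lemma upset_Sup:
  assumes F: "F \<subseteq> carrier (\<E> X)"
  shows "upset X (\<Squnion>\<^bsub>\<E> X\<^esub> F) = (\<Union>A\<in>F. upset X A)"
proof
  interpret complete_lattice "\<E> X" by (rule complete_lattice_\<E>)
  have closed: "\<Squnion>\<^bsub>\<E> X\<^esub> F \<in> carrier (\<E> X)" using F by (rule sup_closed)
  have "\<Union>F \<subseteq> finite_intervals X" using F carrier_\<E>_subset by blast
  \<comment> \<open>The minimal members of the union of \<open>F\<close> form an upper bound
    \<open>M\<close> of \<open>F\<close>. The join lies below \<open>M\<close>, and everything above
    a member of \<open>M\<close> is above a member of some element of \<open>F\<close>.\<close>
  then obtain M where M: "M \<in> carrier (\<E> X)" "M \<subseteq> \<Union>F" "\<forall>I\<in>\<Union>F. \<exists>J\<in>M. J \<subseteq> I"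
    using minimal_members[of "\<Union>F" X] by blast
  have "A \<sqsubseteq>\<^bsub>\<E> X\<^esub> M" if "A \<in> F" for A
    using M(3) that unfolding le_\<E> by blast
  then have "M \<in> Upper (\<E> X) F" using M(1) by (auto simp: Upper_def)
  then have "\<Squnion>\<^bsub>\<E> X\<^esub> F \<sqsubseteq>\<^bsub>\<E> X\<^esub> M" using F M(1) by (intro sup_least) auto
  then have "upset X (\<Squnion>\<^bsub>\<E> X\<^esub> F) \<subseteq> upset X M" using closed by (simp add: le_\<E>_iff_upset)
  also have "\<dots> \<subseteq> (\<Union>A\<in>F. upset X A)" using M(2) unfolding upset_def by blast
  finally show "upset X (\<Squnion>\<^bsub>\<E> X\<^esub> F) \<subseteq> (\<Union>A\<in>F. upset X A)" .
  have "upset X A \<subseteq> upset X (\<Squnion>\<^bsub>\<E> X\<^esub> F)" if "A \<in> F" for A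
    using F that by (subst le_\<E>_iff_upset[symmetric]) (auto intro: sup_upper)
  then show "(\<Union>A\<in>F. upset X A) \<subseteq> upset X (\<Squnion>\<^bsub>\<E> X\<^esub> F)" by blast
qed

lemma upset_join:
  assumes "A \<in> carrier (\<E> X)" "B \<in> carrier (\<E> X)"
  shows "upset X (A \<squnion>\<^bsub>\<E> X\<^esub> B) = upset X A \<union> upset X B"
proof -
  have "upset X (A \<squnion>\<^bsub>\<E> X\<^esub> B) = (\<Union>C\<in>{A, B}. upset X C)"
    unfolding join_def using assms by (intro upset_Sup) simp
  then show ?thesis by simp
qed

lemma join_\<E>_closed:
  assumes "A \<in> carrier (\<E> X)" "B \<in> carrier (\<E> X)"
  shows "A \<squnion>\<^bsub>\<E> X\<^esub> B \<in> carrier (\<E> X)"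
proof -
  interpret complete_lattice "\<E> X" by (rule complete_lattice_\<E>)
  show ?thesis using assms by (rule join_closed)
qed

text \<open>If \<open>I\<close> is to the left of \<open>J\<close>, then the interval from
  \<open>Min I\<close> to \<open>Max J\<close> is the convex hull of their union, and
  \<open>K\<close> is convex.\<close>

lemma interval_in_subset_iff:
  assumes X: "I \<in> finite_intervals X" "J \<in> finite_intervals X"
    and ne: "I \<noteq> {}" "J \<noteq> {}" and IJ: "left_of I J" and K: "K \<in> finite_intervals X"
  shows "interval_in X (Min I) (Max J) \<subseteq> K \<longleftrightarrow> I \<subseteq> K \<and> J \<subseteq> K"
proof
  have fin: "finite I" "finite J" and sub: "I \<subseteq> X" "J \<subseteq> X"
    using X by (auto simp: finite_intervals_def convex_subset_def)
  have mem: "Min I \<in> I" "Max J \<in> J" using fin ne by simp_all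
  \<comment> \<open>The upper bound \<open>Max J\<close> for elements of \<open>I\<close> comes from
    \<open>left_of I J\<close>, as does the lower bound \<open>Min I\<close> for elements of
    \<open>J\<close> below.\<close>
  have "I \<subseteq> interval_in X (Min I) (Max J)"
    using fin sub mem IJ unfolding left_of_def interval_in_def by (auto intro: less_imp_le)
  moreover have "J \<subseteq> interval_in X (Min I) (Max J)"
    using fin sub mem IJ unfolding left_of_def interval_in_def by (auto intro: less_imp_le)
  moreover assume "interval_in X (Min I) (Max J) \<subseteq> K"
  ultimately show "I \<subseteq> K \<and> J \<subseteq> K" by blast
next
  assume "I \<subseteq> K \<and> J \<subseteq> K"
  moreover have "Min I \<in> I" "Max J \<in> J"
    using X ne by (simp_all add: finite_intervals_def)
  ultimately show "interval_in X (Min I) (Max J) \<subseteq> K"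
    using K unfolding finite_intervals_def convex_subset_def by blast
qed

text \<open>Local finiteness makes the generating intervals finite, so that
  \<open>sup_closed\<close> and \<open>upset_Sup\<close> apply to the family.\<close>

lemma ordered_meet_generators_subset:
  assumes lf: "locally_finite_order X"
    and A: "A \<in> carrier (\<E> X)" "A \<noteq> {{}}" and B: "B \<in> carrier (\<E> X)" "B \<noteq> {{}}"
  shows "{{interval_in X (Min I) (Max J)} | I J. I \<in> A \<and> J \<in> B \<and> Max I < Min J}
    \<subseteq> carrier (\<E> X)"
proof clarify
  fix I J assume "I \<in> A" "J \<in> B"
  with A B have "I \<in> finite_intervals X" "I \<noteq> {}" "J \<in> finite_intervals X" "J \<noteq> {}"
    using carrier_\<E>_subset empty_in_\<E> by blast+
  then have "Min I \<in> X" "Max J \<in> X"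
    using Min_in[of I] Max_in[of J] unfolding finite_intervals_def convex_subset_def by blast+
  with lf show "{interval_in X (Min I) (Max J)} \<in> carrier (\<E> X)" by (rule interval_in_\<E>)
qed

lemma ordered_meet_closed:
  assumes "locally_finite_order X" "A \<in> carrier (\<E> X)" "B \<in> carrier (\<E> X)"
  shows "ordered_meet X A B \<in> carrier (\<E> X)"
proof -
  interpret complete_lattice "\<E> X" by (rule complete_lattice_\<E>)
  show ?thesis
    using assms ordered_meet_generators_subset[OF assms(1,2) _ assms(3)]
    by (auto simp: ordered_meet_def intro: sup_closed)
qed

lemma mem_upset_ordered_meet:
  assumes lf: "locally_finite_order X"
    and A: "A \<in> carrier (\<E> X)" and B: "B \<in> carrier (\<E> X)"
  shows "K \<in> upset X (ordered_meet X A B) \<longleftrightarrow>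
    K \<in> finite_intervals X \<and> (\<exists>I\<in>A. \<exists>J\<in>B. left_of I J \<and> I \<subseteq> K \<and> J \<subseteq> K)"
proof (cases "A = {{}} \<or> B = {{}}")
  case True
  \<comment> \<open>The empty interval satisfies \<open>left_of\<close> vacuously and lies in every
    \<open>K\<close>, so only the condition on the other argument remains.\<close>
  then show ?thesis by (auto simp: ordered_meet_def upset_def left_of_def)
next
  case False
  let ?S = "{{interval_in X (Min I) (Max J)} | I J. I \<in> A \<and> J \<in> B \<and> Max I < Min J}"
  have S: "?S \<subseteq> carrier (\<E> X)"
    using False by (intro ordered_meet_generators_subset[OF lf A _ B]) simp_all
  have mem: "I \<in> finite_intervals X \<and> I \<noteq> {} \<and> J \<in> finite_intervals X \<and> J \<noteq> {}"
    if "I \<in> A" "J \<in> B" for I J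
    using that A B False carrier_\<E>_subset empty_in_\<E> by blast
  have lo: "Max I < Min J \<longleftrightarrow> left_of I J" if "I \<in> A" "J \<in> B" for I J
    using mem[OF that] left_of_iff_Max_less_Min[of I J] by (simp add: finite_intervals_def)
  have "K \<in> upset X (ordered_meet X A B) \<longleftrightarrow> K \<in> (\<Union>G\<in>?S. upset X G)"
    using False upset_Sup[OF S] by (simp add: ordered_meet_def)
  also have "\<dots> \<longleftrightarrow> K \<in> finite_intervals X \<and>
      (\<exists>I\<in>A. \<exists>J\<in>B. Max I < Min J \<and> interval_in X (Min I) (Max J) \<subseteq> K)"
    unfolding upset_def by blast
  also have "\<dots> \<longleftrightarrow> K \<in> finite_intervals X \<and>
      (\<exists>I\<in>A. \<exists>J\<in>B. left_of I J \<and> I \<subseteq> K \<and> J \<subseteq> K)"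
  \<comment> \<open>The equivalence is checked for each pair \<open>I\<close>, \<open>J\<close>
    separately, where \<open>K\<close> contains the hull iff it contains both intervals.\<close>
  proof (rule conj_cong[OF refl], rule bex_cong[OF refl], rule bex_cong[OF refl])
    fix I J assume "K \<in> finite_intervals X" and IJ: "I \<in> A" "J \<in> B"
    then show "Max I < Min J \<and> interval_in X (Min I) (Max J) \<subseteq> K \<longleftrightarrow>
        left_of I J \<and> I \<subseteq> K \<and> J \<subseteq> K"
      using mem[OF IJ] lo[OF IJ] interval_in_subset_iff[of I X J K] by auto
  qed
  finally show ?thesis .
qed

text \<open>Shrinking intervals preserves \<open>left_of\<close> and containment in
  \<open>K\<close>, so the witnesses may range over the up-sets instead of the antichains. In this
  form a join in either argument becomes a union under an existential quantifier.\<close>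

lemma upset_ordered_meet:
  assumes "locally_finite_order X" and A: "A \<in> carrier (\<E> X)" and B: "B \<in> carrier (\<E> X)"
  shows "upset X (ordered_meet X A B) =
    {K \<in> finite_intervals X. \<exists>I\<in>upset X A. \<exists>J\<in>upset X B. left_of I J \<and> I \<subseteq> K \<and> J \<subseteq> K}"
    (is "_ = ?R")
proof (rule Set.set_eqI)
  fix K
  have "(\<exists>I\<in>A. \<exists>J\<in>B. left_of I J \<and> I \<subseteq> K \<and> J \<subseteq> K) \<longleftrightarrow>
    (\<exists>I\<in>upset X A. \<exists>J\<in>upset X B. left_of I J \<and> I \<subseteq> K \<and> J \<subseteq> K)" (is "?l \<longleftrightarrow> ?r")
  proof
    have "A \<subseteq> upset X A" "B \<subseteq> upset X B"
      using A B by (simp_all add: subset_upset)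
    then show "?l \<Longrightarrow> ?r" by (meson subsetD)
  next
    assume ?r
    then obtain I' J' where "I' \<in> upset X A" "J' \<in> upset X B"
      and IJ': "left_of I' J'" "I' \<subseteq> K" "J' \<subseteq> K" by blast
    \<comment> \<open>Each witness from an up-set is replaced by a member of the antichain inside
      it.\<close>
    then obtain I J where "I \<in> A" "I \<subseteq> I'" "J \<in> B" "J \<subseteq> J'"
      unfolding upset_def by blast
    moreover from this have "left_of I J" using left_of_mono[OF IJ'(1)] by simp
    ultimately show ?l using IJ'(2,3) by (meson subset_trans)
  qed
  then show "K \<in> upset X (ordered_meet X A B) \<longleftrightarrow> K \<in> ?R"
    using mem_upset_ordered_meet[OF assms] by simp
qed

theorem theorem26:
  fixes X :: "'a::linorder set"
  assumes "locally_finite_order X"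
    and "A \<in> carrier (\<E> X)" and "B \<in> carrier (\<E> X)" and "C \<in> carrier (\<E> X)"
  shows "ordered_meet X (A \<squnion>\<^bsub>\<E> X\<^esub> B) C = ordered_meet X A C \<squnion>\<^bsub>\<E> X\<^esub> ordered_meet X B C
    \<and> ordered_meet X A (B \<squnion>\<^bsub>\<E> X\<^esub> C) = ordered_meet X A B \<squnion>\<^bsub>\<E> X\<^esub> ordered_meet X A C"
proof (intro conjI; rule upset_inject[of _ X])
  \<comment> \<open>Equality of antichains has been reduced to equality of up-sets. These rules turn
    both sides into bounded existentials over up-sets and their unions, which leaves pure
    logic.\<close>
  note [simp] = assms join_\<E>_closed ordered_meet_closed upset_join upset_ordered_meet
  show "upset X (ordered_meet X (A \<squnion>\<^bsub>\<E> X\<^esub> B) C) =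
      upset X (ordered_meet X A C \<squnion>\<^bsub>\<E> X\<^esub> ordered_meet X B C)"
    by simp blast
  show "upset X (ordered_meet X A (B \<squnion>\<^bsub>\<E> X\<^esub> C)) =
      upset X (ordered_meet X A B \<squnion>\<^bsub>\<E> X\<^esub> ordered_meet X A C)"
    by simp blast
qed (use assms in \<open>simp_all add: join_\<E>_closed ordered_meet_closed\<close>)

end
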